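(* Let $K\subset\mathbb{R}^2$ be a convex body with $0\in\operatorname{int}K$. Then $K$ is centrally symmetric with center at $0$ (that is, $K=-K$) under either one of the following conditions: (i) for any three distinct vectors $a,b,c\in\partial K$ contained in a closed halfplane whose bounding line goes through $0$, one has $a+b+c\notin\operatorname{int}K$; (ii) for any three distinct vectors $a,b,c\in\partial K$ with $0\in\operatorname{int}\operatorname{conv}\{a,b,c\}$, one has $a+b+c\in\operatorname{int}K$.
   Context: A convex body in $\mathbb{R}^2$ is a compact convex set with non-empty interior. $\operatorname{int}$, $\partial$ and $\operatorname{conv}$ denote interior, boundary and convex hull in $\mathbb{R}^2$. *)

theory Defs
  imports "HOL-Analysis.Analysis"
begin

definition convex_body :: "'a::euclidean_space set \<Rightarrow> bool" where
  "convex_body K \<longleftrightarrow> compact K \<and> convex K \<and> interior K \<noteq> {}"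

end

theory Submission
  imports Defs
begin

text \<open>
  If \<open>K\<close> is not symmetric, some chord through the origin is divided unequally by it: there are
  boundary points \<open>a\<close> and \<open>- t a\<close> with \<open>0 < t < 1\<close>
  (\<open>asymmetric_imp_unequal_chord\<close>). Degenerate triples that repeat an endpoint of this chord
  violate both conditions strictly:

  \<^item> \<open>a\<close>, \<open>- t a\<close>, \<open>- t a\<close> lie on a line through the origin, hence in a closed halfplane, while
    their sum \<open>(1 - 2 t) a\<close> is strictly between the endpoints \<open>- t a\<close> and \<open>a\<close>, so it lies in
    the interior of \<open>K\<close>;
  \<^item> \<open>a\<close>, \<open>a\<close>, \<open>- t a\<close> have the origin in the relative interior of their convex hull, while
    their sum \<open>(2 - t) a\<close> is beyond \<open>a\<close>, so it lies outside \<open>K\<close>.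

  Both positions of the sum are open conditions, so they survive a small perturbation of the
  points along the boundary. It remains to perturb so that the points become distinct and
  the halfplane condition, respectively the condition that the origin is interior to the triangle,
  holds. What makes such perturbations available is that the radial projection onto the boundary
  is continuous (\<open>frontier_point_on_nearby_ray\<close>).
\<close>

section \<open>Rays from an interior point\<close>

lemma convex_scaleR_in_interior:
  fixes K :: "'a::euclidean_space set"
  assumes "convex K" "0 \<in> interior K" "x \<in> K" "0 \<le> s" "s < 1"
  shows "s *\<^sub>R x \<in> interior K"
  using mem_interior_convex_shrink[OF assms(1-3), of "1 - s"] assms(4,5)
  by (simp add: algebra_simps)

lemma frontier_scaleR_notin:
  fixes K :: "'a::euclidean_space set"
  assumes "convex K" "0 \<in> interior K" "a \<in> frontier K" "1 < s"
  shows "s *\<^sub>R a \<notin> K"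
proof
  assume "s *\<^sub>R a \<in> K"
  then have "(1 / s) *\<^sub>R (s *\<^sub>R a) \<in> interior K"
    using assms by (intro convex_scaleR_in_interior) auto
  then show False
    using assms by (simp add: frontier_def)
qed

text \<open>
  This is continuity of the radial projection at \<open>a\<close>. On the ray through \<open>a\<close>, the points
  \<open>(1 - \<eta>) a\<close> and \<open>(1 + \<eta>) a\<close> lie in the interior and in the exterior of \<open>K\<close>; both are open
  conditions, so the same factors separate the boundary point on any nearby ray.
\<close>

lemma frontier_point_on_nearby_ray:
  fixes K :: "'a::euclidean_space set"
  assumes "convex K" "closed K" "0 \<in> interior K" "a \<in> frontier K" "0 < e"
  shows "\<forall>\<^sub>F w in nhds a. \<exists>s>0. s *\<^sub>R w \<in> frontier K \<and> dist (s *\<^sub>R w) a < e"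
proof -
  have aK: "a \<in> K"
    using assms by (simp add: frontier_def)
  have a0: "a \<noteq> 0"
    using assms by (auto simp: frontier_def)
  define \<eta> where "\<eta> = min (1/2) (e / (2 * norm a))"
  have \<eta>: "0 < \<eta>" "\<eta> < 1"
    using a0 \<open>0 < e\<close> by (auto simp: \<eta>_def min_def)
  have \<eta>_norm: "\<eta> * norm a \<le> e / 2"
  proof -
    have "\<eta> * norm a \<le> e / (2 * norm a) * norm a"
      by (intro mult_right_mono) (auto simp: \<eta>_def)
    then show ?thesis using a0 by simp
  qed
  have inner: "(1 - \<eta>) *\<^sub>R a \<in> interior K"
    using \<eta> assms aK by (intro convex_scaleR_in_interior) auto
  have outer: "(1 + \<eta>) *\<^sub>R a \<in> - K"
    using frontier_scaleR_notin[OF assms(1,3,4), of "1 + \<eta>"] \<eta> by simp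
  have lim: "((\<lambda>w. c *\<^sub>R w) \<longlongrightarrow> c *\<^sub>R a) (nhds a)" for c
    by (intro tendsto_intros filterlim_ident)
  have "\<forall>\<^sub>F w in nhds a. (1 - \<eta>) *\<^sub>R w \<in> interior K"
    using topological_tendstoD[OF lim open_interior inner] .
  moreover have "\<forall>\<^sub>F w in nhds a. (1 + \<eta>) *\<^sub>R w \<in> - K"
    using topological_tendstoD[OF lim _ outer] assms(2) by (simp add: open_Compl)
  moreover have "\<forall>\<^sub>F w in nhds a. dist w a < e / 4"
    unfolding eventually_nhds_metric using \<open>0 < e\<close> by (intro exI[of _ "e / 4"]) auto
  ultimately show ?thesis
  proof eventually_elim
    case (elim w)
    let ?S = "(\<lambda>s. s *\<^sub>R w) ` {1 - \<eta>..1 + \<eta>}"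
    have "connected ?S"
      by (intro connected_continuous_image continuous_intros) auto
    moreover have "(1 - \<eta>) *\<^sub>R w \<in> ?S \<inter> K"
      using elim(1) interior_subset \<eta> by auto
    moreover have "(1 + \<eta>) *\<^sub>R w \<in> ?S - K"
      using elim(2) \<eta> by auto
    ultimately have "?S \<inter> frontier K \<noteq> {}"
      using connected_Int_frontier by blast
    then obtain s where s: "1 - \<eta> \<le> s" "s \<le> 1 + \<eta>" "s *\<^sub>R w \<in> frontier K"
      by auto
    have "s *\<^sub>R w - a = s *\<^sub>R (w - a) + (s - 1) *\<^sub>R a"
      by (simp add: algebra_simps)
    then have "dist (s *\<^sub>R w) a \<le> \<bar>s\<bar> * norm (w - a) + \<bar>s - 1\<bar> * norm a"
      by (metis dist_norm norm_scaleR norm_triangle_ineq)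
    also have "\<dots> \<le> 2 * norm (w - a) + \<eta> * norm a"
      using s(1,2) \<eta> by (intro add_mono mult_right_mono) auto
    also have "\<dots> < e"
      using elim(3) \<eta>_norm by (simp add: dist_norm)
    finally show ?case
      using s \<eta> by (intro exI[of _ s]) auto
  qed
qed

section \<open>An unequally divided chord\<close>

text \<open>
  Take \<open>x \<in> K\<close> with \<open>- x \<notin> K\<close>: the boundary is met at or after \<open>x\<close> on its ray, but strictly
  before \<open>- x\<close> on the opposite ray.
\<close>

lemma asymmetric_imp_unequal_chord:
  fixes K :: "'a::euclidean_space set"
  assumes "convex K" "compact K" "0 \<in> interior K" "K \<noteq> uminus ` K"
  obtains a t where "a \<in> frontier K" "0 < t" "t < 1" "- (t *\<^sub>R a) \<in> frontier K"
proof -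
  have "\<exists>x\<in>K. - x \<notin> K"
    using assms(4) by (metis image_eqI minus_minus subsetI subset_antisym image_subsetI)
  then obtain x where x: "x \<in> K" "- x \<notin> K"
    by blast
  have "x \<noteq> 0"
    using x by auto
  have "bounded K" "closed K"
    using assms(2) by (auto simp: compact_imp_bounded compact_imp_closed)
  obtain d where d: "0 < d" "d *\<^sub>R x \<in> frontier K"
    using ray_to_frontier[OF \<open>bounded K\<close> assms(3) \<open>x \<noteq> 0\<close>] by auto
  obtain d' where d': "0 < d'" "- (d' *\<^sub>R x) \<in> frontier K"
      "\<And>e. \<lbrakk>0 \<le> e; e < d'\<rbrakk> \<Longrightarrow> - (e *\<^sub>R x) \<in> interior K"
    using ray_to_frontier[OF \<open>bounded K\<close> assms(3), of "- x"] \<open>x \<noteq> 0\<close> by auto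
  have "1 \<le> d"
    using convex_scaleR_in_interior[OF assms(1,3) x(1), of d] d
    by (force simp: frontier_def)
  moreover have "d' < 1"
  proof (rule ccontr)
    assume "\<not> d' < 1"
    then consider "d' = 1" | "1 < d'" by linarith
    then have "- x \<in> K"
    proof cases
      case 1
      then show ?thesis using d'(2) \<open>closed K\<close> by (simp add: frontier_def)
    next
      case 2
      then show ?thesis using d'(3)[of 1] interior_subset by auto
    qed
    then show False using x by blast
  qed
  ultimately show ?thesis
    using d d' by (intro that[of "d *\<^sub>R x" "d' / d"]) auto
qed

section \<open>Triples violating the two conditions\<close>

text \<open>
  Here \<open>u\<close> is normal to the chord. The third point is obtained by moving the endpoint
  \<open>- t a\<close> along the boundary into the side \<open>u \<bullet> x > 0\<close>; this keeps all three points in the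
  halfplane \<open>u \<bullet> x \<ge> 0\<close>.
\<close>

lemma unequal_chord_imp_halfplane_triple:
  fixes K :: "'a::euclidean_space set"
  assumes K: "convex K" "closed K" "0 \<in> interior K"
    and chord: "a \<in> frontier K" "0 < t" "t < 1" "- (t *\<^sub>R a) \<in> frontier K"
    and u: "u \<noteq> 0" "u \<bullet> a = 0"
  obtains c where "c \<in> frontier K" "u \<bullet> c > 0" "a + - (t *\<^sub>R a) + c \<in> interior K"
proof -
  define b where "b = - (t *\<^sub>R a)"
  have ab: "a \<in> K" "b \<in> K" "b \<in> frontier K"
    using K chord by (auto simp: b_def frontier_def)
  have sum_eq: "a + b + b = (1 - t - t) *\<^sub>R a"
    unfolding b_def scaleR_diff_left by simp
  have "a + b + b \<in> interior K"
  proof (cases "t \<le> 1/2")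
    case True
    then show ?thesis
      unfolding sum_eq using K ab chord by (intro convex_scaleR_in_interior) auto
  next
    case False
    \<comment> \<open>Now the sum lies on the short side of the chord: \<open>(1 - 2 t) a = ((2 t - 1) / t) b\<close>.\<close>
    then have "((2 * t - 1) / t) *\<^sub>R b \<in> interior K"
      using K ab chord by (intro convex_scaleR_in_interior) (auto simp: field_simps)
    moreover have "b = (- t) *\<^sub>R a" "(2 * t - 1) / t * (- t) = 1 - t - t"
      using chord by (simp_all add: b_def)
    ultimately show ?thesis
      unfolding sum_eq by (metis scaleR_scaleR)
  qed
  then obtain e where e: "0 < e" "ball (a + b + b) e \<subseteq> interior K"
    using open_contains_ball open_interior by blast
  have "((\<lambda>\<epsilon>. b + \<epsilon> *\<^sub>R u) \<longlongrightarrow> b + 0 *\<^sub>R u) (at_right 0)"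
    by (intro tendsto_intros)
  then have "filterlim (\<lambda>\<epsilon>. b + \<epsilon> *\<^sub>R u) (nhds b) (at_right 0)"
    by simp
  then have "\<forall>\<^sub>F \<epsilon> in at_right 0. \<exists>s>0. s *\<^sub>R (b + \<epsilon> *\<^sub>R u) \<in> frontier K
      \<and> dist (s *\<^sub>R (b + \<epsilon> *\<^sub>R u)) b < e"
    using frontier_point_on_nearby_ray[OF K ab(3) e(1)] by (auto dest: eventually_compose_filterlim)
  then have "\<forall>\<^sub>F \<epsilon> in at_right (0::real). 0 < \<epsilon> \<and> (\<exists>s>0. s *\<^sub>R (b + \<epsilon> *\<^sub>R u) \<in> frontier K
      \<and> dist (s *\<^sub>R (b + \<epsilon> *\<^sub>R u)) b < e)"
    using eventually_at_right_less by eventually_elim auto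
  then obtain \<epsilon> s where \<epsilon>: "0 < \<epsilon>" and s: "0 < s" "s *\<^sub>R (b + \<epsilon> *\<^sub>R u) \<in> frontier K"
      "dist (s *\<^sub>R (b + \<epsilon> *\<^sub>R u)) b < e"
    using eventually_happens'[OF trivial_limit_at_right_real] by blast
  define c where "c = s *\<^sub>R (b + \<epsilon> *\<^sub>R u)"
  have "u \<bullet> c = s * \<epsilon> * (u \<bullet> u)"
    using u by (simp add: c_def b_def inner_diff_right)
  then have "u \<bullet> c > 0"
    using s \<epsilon> u by simp
  moreover have "a + b + c \<in> interior K"
    using s e(2) by (auto simp: c_def dist_commute subset_iff)
  ultimately show ?thesis
    using that s(2) by (auto simp: c_def b_def)
qed

text \<open>
  A positive relation puts the origin into the open triangle once the triangle is nondegenerate;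
  a degenerate triangle would put the origin on the line through \<open>a\<close> and \<open>c\<close>.
\<close>

lemma zero_in_interior_triangle:
  fixes a b c :: "'a::euclidean_space"
  assumes "DIM('a) = 2" and indep: "\<not> collinear {0, a, c}"
    and pos: "0 < x" "0 < y" "0 < z" and rel: "x *\<^sub>R a + y *\<^sub>R b + z *\<^sub>R c = 0"
  shows "0 \<in> interior (convex hull {a, b, c})"
proof -
  define m where "m = x + y + z"
  have m: "0 < m"
    using pos by (simp add: m_def)
  have sum1: "x / m + y / m + z / m = 1"
    using m by (simp add: m_def flip: add_divide_distrib)
  have "(x / m) *\<^sub>R a + (y / m) *\<^sub>R b + (z / m) *\<^sub>R c
      = (1 / m) *\<^sub>R (x *\<^sub>R a + y *\<^sub>R b + z *\<^sub>R c)"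
    by (simp add: scaleR_add_right)
  then have comb: "(x / m) *\<^sub>R a + (y / m) *\<^sub>R b + (z / m) *\<^sub>R c = 0"
    using rel by simp
  have "\<not> collinear {a, b, c}"
  proof
    assume "collinear {a, b, c}"
    moreover have "a \<noteq> c"
      using indep by auto
    ultimately have "b \<in> affine hull {a, c}"
      by (metis collinear_3_affine_hull insert_commute)
    moreover have "a \<in> affine hull {a, c}" "c \<in> affine hull {a, c}"
      by (auto simp: hull_inc)
    ultimately have "0 \<in> affine hull {a, c}"
      using mem_affine_3[OF affine_affine_hull _ _ _ sum1] comb by metis
    then show False
      using \<open>a \<noteq> c\<close> indep by (metis collinear_3_affine_hull insert_commute)
  qed
  from interior_convex_hull_3_minimal[OF this assms(1)] show ?thesis
    using m pos sum1 comb by simp (meson divide_pos_pos)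
qed

text \<open>
  One copy of \<open>a\<close> moves to the ray of \<open>w = a + \<epsilon> u\<close>, and \<open>- t a\<close> to the ray of \<open>- (a + w)\<close>.
  The relation \<open>a + w - (a + w) = 0\<close> then puts the origin inside the triangle, however far out
  the boundary points lie on the three rays.
\<close>

lemma unequal_chord_imp_triangle_triple:
  fixes K :: "'a::euclidean_space set"
  assumes dim: "DIM('a) = 2"
    and K: "convex K" "closed K" "0 \<in> interior K"
    and chord: "a \<in> frontier K" "0 < t" "t < 1" "- (t *\<^sub>R a) \<in> frontier K"
    and u: "u \<noteq> 0" "u \<bullet> a = 0"
  obtains b c where "b \<in> frontier K" "c \<in> frontier K" "u \<bullet> b < 0" "u \<bullet> c > 0"
    "0 \<in> interior (convex hull {a, b, c})" "a + b + c \<notin> K"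
proof -
  have a0: "a \<noteq> 0"
    using K chord by (auto simp: frontier_def)
  have "(2 - t) *\<^sub>R a \<in> - K"
    using frontier_scaleR_notin[OF K(1,3) chord(1), of "2 - t"] chord by simp
  then obtain e where e: "0 < e" "ball ((2 - t) *\<^sub>R a) e \<subseteq> - K"
    using K(2) by (meson open_Compl open_contains_ball)
  define w where "w \<epsilon> = a + \<epsilon> *\<^sub>R u" for \<epsilon>
  \<comment> \<open>Scaling by \<open>t / 2\<close> makes \<open>v \<epsilon>\<close> tend to the endpoint \<open>- t a\<close> itself.\<close>
  define v where "v \<epsilon> = (- t / 2) *\<^sub>R (a + w \<epsilon>)" for \<epsilon>
  have w_lim: "(w \<longlongrightarrow> a + 0 *\<^sub>R u) (at_right 0)"
    unfolding w_def by (intro tendsto_intros)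
  have "(v \<longlongrightarrow> (- t / 2) *\<^sub>R (a + (a + 0 *\<^sub>R u))) (at_right 0)"
    unfolding v_def by (intro tendsto_intros w_lim)
  moreover have "(- t / 2) *\<^sub>R (a + (a + 0 *\<^sub>R u)) = - (t *\<^sub>R a)"
    by (simp flip: scaleR_2)
  ultimately have v_lim: "filterlim v (nhds (- (t *\<^sub>R a))) (at_right 0)"
    by simp
  have "\<forall>\<^sub>F \<epsilon> in at_right 0. \<exists>s>0. s *\<^sub>R w \<epsilon> \<in> frontier K \<and> dist (s *\<^sub>R w \<epsilon>) a < e / 2"
    using eventually_compose_filterlim[OF frontier_point_on_nearby_ray[OF K chord(1), of "e / 2"]]
      w_lim e(1) by (simp del: less_divide_eq_numeral1)
  moreover have "\<forall>\<^sub>F \<epsilon> in at_right 0. \<exists>s>0. s *\<^sub>R v \<epsilon> \<in> frontier K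
      \<and> dist (s *\<^sub>R v \<epsilon>) (- (t *\<^sub>R a)) < e / 2"
    using eventually_compose_filterlim[OF frontier_point_on_nearby_ray[OF K chord(4), of "e / 2"]]
      v_lim e(1) by (simp del: less_divide_eq_numeral1)
  ultimately have "\<forall>\<^sub>F \<epsilon> in at_right 0. 0 < \<epsilon>
      \<and> (\<exists>s>0. s *\<^sub>R w \<epsilon> \<in> frontier K \<and> dist (s *\<^sub>R w \<epsilon>) a < e / 2)
      \<and> (\<exists>s>0. s *\<^sub>R v \<epsilon> \<in> frontier K \<and> dist (s *\<^sub>R v \<epsilon>) (- (t *\<^sub>R a)) < e / 2)"
    using eventually_at_right_less by eventually_elim auto
  then obtain \<epsilon> s r where \<epsilon>: "0 < \<epsilon>"
    and s: "0 < s" "s *\<^sub>R w \<epsilon> \<in> frontier K" "dist (s *\<^sub>R w \<epsilon>) a < e / 2"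
    and r: "0 < r" "r *\<^sub>R v \<epsilon> \<in> frontier K" "dist (r *\<^sub>R v \<epsilon>) (- (t *\<^sub>R a)) < e / 2"
    using eventually_happens'[OF trivial_limit_at_right_real] by blast
  define b where "b = r *\<^sub>R v \<epsilon>"
  define c where "c = s *\<^sub>R w \<epsilon>"
  have "u \<bullet> c = s * \<epsilon> * (u \<bullet> u)" "u \<bullet> b = - (r * (t / 2) * \<epsilon> * (u \<bullet> u))"
    using u by (simp_all add: b_def c_def v_def w_def inner_add_right)
  then have sides: "u \<bullet> c > 0" "u \<bullet> b < 0"
    using s r \<epsilon> u chord by auto
  have "\<not> collinear {0, a, c}"
    using sides a0 u by (auto simp: collinear_lemma)
  moreover have "1 *\<^sub>R a + (2 / (t * r)) *\<^sub>R b + (1 / s) *\<^sub>R c = 0"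
    using s r chord by (simp add: b_def c_def v_def)
  ultimately have "0 \<in> interior (convex hull {a, b, c})"
    using s r chord
    by (intro zero_in_interior_triangle[OF dim, where x = 1 and y = "2 / (t * r)" and z = "1 / s"]) auto
  moreover have "a + b + c \<notin> K"
  proof -
    have "(2 - t) *\<^sub>R a - (a + b + c) = - ((b + t *\<^sub>R a) + (c - a))"
      by (simp add: algebra_simps scaleR_2)
    then have "dist ((2 - t) *\<^sub>R a) (a + b + c) \<le> norm (b + t *\<^sub>R a) + norm (c - a)"
      by (metis dist_norm norm_minus_cancel norm_triangle_ineq)
    also have "\<dots> < e"
      using s(3) r(3) by (simp add: b_def c_def dist_norm)
    finally show ?thesis
      using e(2) by auto
  qed
  ultimately show ?thesis
    using that[of b c] sides s r by (auto simp: b_def c_def)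
qed

section \<open>Central symmetry\<close>

theorem theorem6:
  fixes K :: "(real ^ 2) set"
  assumes "convex_body K"
    and "0 \<in> interior K"
    and "(\<forall>a\<in>frontier K. \<forall>b\<in>frontier K. \<forall>c\<in>frontier K.
            a \<noteq> b \<longrightarrow> a \<noteq> c \<longrightarrow> b \<noteq> c \<longrightarrow>
            (\<exists>u. u \<noteq> 0 \<and> {a, b, c} \<subseteq> {x. u \<bullet> x \<ge> 0}) \<longrightarrow>
            a + b + c \<notin> interior K)
       \<or> (\<forall>a\<in>frontier K. \<forall>b\<in>frontier K. \<forall>c\<in>frontier K.
            a \<noteq> b \<longrightarrow> a \<noteq> c \<longrightarrow> b \<noteq> c \<longrightarrow>
            0 \<in> interior (convex hull {a, b, c}) \<longrightarrow>
            a + b + c \<in> interior K)"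
  shows "K = uminus ` K"
proof (rule ccontr)
  assume asym: "K \<noteq> uminus ` K"
  have K: "convex K" "compact K"
    using assms(1) by (auto simp: convex_body_def)
  note Kc = K(1) compact_imp_closed[OF K(2)] assms(2)
  obtain a t where chord: "a \<in> frontier K" "0 < t" "t < 1" "- (t *\<^sub>R a) \<in> frontier K"
    using asymmetric_imp_unequal_chord[OF K assms(2) asym] .
  obtain u :: "real ^ 2" where u: "u \<noteq> 0" "u \<bullet> a = 0"
    using orthogonal_to_vector_exists[of a] by (auto simp: orthogonal_def inner_commute)
  from assms(3) show False
  proof
    assume i: "\<forall>a\<in>frontier K. \<forall>b\<in>frontier K. \<forall>c\<in>frontier K.
            a \<noteq> b \<longrightarrow> a \<noteq> c \<longrightarrow> b \<noteq> c \<longrightarrow>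
            (\<exists>u. u \<noteq> 0 \<and> {a, b, c} \<subseteq> {x. u \<bullet> x \<ge> 0}) \<longrightarrow>
            a + b + c \<notin> interior K"
    obtain c where c: "c \<in> frontier K" "u \<bullet> c > 0" "a + - (t *\<^sub>R a) + c \<in> interior K"
      using unequal_chord_imp_halfplane_triple[OF Kc chord u] .
    have "a \<noteq> 0"
      using chord(1) assms(2) by (auto simp: frontier_def)
    have "a \<noteq> - (t *\<^sub>R a)"
    proof
      assume "a = - (t *\<^sub>R a)"
      then have "(1 + t) *\<^sub>R a = 0"
        by (simp add: scaleR_add_left eq_neg_iff_add_eq_0)
      then show False
        using \<open>a \<noteq> 0\<close> chord(2) by simp
    qed
    moreover have "a \<noteq> c" "- (t *\<^sub>R a) \<noteq> c"
      using c(2) u(2) by auto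
    moreover have "\<exists>u. u \<noteq> 0 \<and> {a, - (t *\<^sub>R a), c} \<subseteq> {x. u \<bullet> x \<ge> 0}"
      using u c(2) by (intro exI[of _ u]) auto
    ultimately show False
      using i chord(1,4) c(1,3) by blast
  next
    assume ii: "\<forall>a\<in>frontier K. \<forall>b\<in>frontier K. \<forall>c\<in>frontier K.
            a \<noteq> b \<longrightarrow> a \<noteq> c \<longrightarrow> b \<noteq> c \<longrightarrow>
            0 \<in> interior (convex hull {a, b, c}) \<longrightarrow>
            a + b + c \<in> interior K"
    obtain b c where bc: "b \<in> frontier K" "c \<in> frontier K" "u \<bullet> b < 0" "u \<bullet> c > 0"
      "0 \<in> interior (convex hull {a, b, c})" "a + b + c \<notin> K"
      using unequal_chord_imp_triangle_triple[OF _ Kc chord u] by auto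
    have "a \<noteq> b" "a \<noteq> c" "b \<noteq> c"
      using bc(3,4) u(2) by auto
    then show False
      using ii chord(1) bc interior_subset by blast
  qed
qed

end
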